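(* Let $\mathcal{L}=\{\ell_1,\dots,\ell_k\}$ be a line arrangement of $k$ lines in $\mathbb{P}^2_{\mathbb{C}}$ with $t_k=t_{k-1}=0$. Then the Levi graph associated to $\mathcal{L}$ contains an induced cycle $\mathbf{C}_8$ of length $8$.
   Context: A line arrangement $\mathcal{L}=\{\ell_1,\dots,\ell_k\}$ is a finite collection of $k$ distinct lines in $\mathbb{P}^2_{\mathbb{C}}$. $\mathrm{Sing}(\mathcal{L})$ is the set of points lying on at least two lines of $\mathcal{L}$ (the intersection points). $t_r=t_r(\mathcal{L})$ is the number of $r$-fold points in $\mathrm{Sing}(\mathcal{L})$, i.e. points through which exactly $r$ lines of $\mathcal{L}$ pass. The Levi graph of $\mathcal{L}$ is the bipartite graph with one vertex for each point of $\mathrm{Sing}(\mathcal{L})$ and one vertex for each line of $\mathcal{L}$, a point vertex and a line vertex being adjacent iff the point lies on the line. $\mathbf{C}_n$ denotes the cycle on $n$ vertices; an induced $\mathbf{C}_n$ in a graph is an induced subgraph isomorphic to $\mathbf{C}_n$.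
   Formalization: The arrangement is assumed to have k ≥ 2 lines; for k = 0 or 1 there are no intersection points, so the conditions on t_k and t_{k-1} hold vacuously while the Levi graph has at most one vertex and no induced cycle of length 8. *)

theory Defs
  imports "HOL-Analysis.Analysis" "Graph_Theory.Graph_Theory"
begin

section \<open>Lines in the complex projective plane\<close>

text \<open>
  A point of the projective plane is a 1-dimensional linear subspace of complex 3-space, and a line
  is the set of all points contained in a 2-dimensional linear subspace. The notions
  \<open>vec.subspace\<close> and \<open>vec.dim\<close> refer to the vector space structure over the complex
  numbers; the unqualified \<open>subspace\<close> and \<open>dim\<close> would refer to the one over the reals.
\<close>

type_synonym proj_point = "(complex ^ 3) set"
type_synonym proj_line = "proj_point set"

definition proj_points :: "proj_point set" where
  "proj_points = {p. vec.subspace p \<and> vec.dim p = 1}"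

definition proj_lines :: "proj_line set" where
  "proj_lines = {{p \<in> proj_points. p \<subseteq> W} | W :: (complex ^ 3) set. vec.subspace W \<and> vec.dim W = 2}"

definition line_arrangement :: "proj_line set \<Rightarrow> bool" where
  "line_arrangement L \<longleftrightarrow> finite L \<and> L \<subseteq> proj_lines"

definition Sing :: "proj_line set \<Rightarrow> proj_point set" where
  "Sing L = {p \<in> proj_points. \<exists>l\<in>L. \<exists>m\<in>L. l \<noteq> m \<and> p \<in> l \<and> p \<in> m}"

text \<open>
  The number $t_r$ of \<open>r\<close>-fold points. Only points of \<open>Sing L\<close> are counted, so the
  number is \<open>0\<close> for \<open>r < 2\<close>. The set is finite for every line arrangement, see
  \<open>finite_Sing\<close> below.
\<close>

definition num_fold_points :: "nat \<Rightarrow> proj_line set \<Rightarrow> nat" where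
  "num_fold_points r L = card {p \<in> Sing L. card {l \<in> L. p \<in> l} = r}"

section \<open>Levi graphs and cycles\<close>

text \<open>
  Following the graph library, an undirected graph is a symmetric digraph: an edge between
  \<open>u\<close> and \<open>v\<close> is represented by the two arcs \<open>(u, v)\<close> and \<open>(v, u)\<close>.
\<close>

definition levi_graph :: "proj_line set \<Rightarrow> (proj_point + proj_line) pair_pre_digraph" where
  "levi_graph L =
    \<lparr> pverts = Inl ` Sing L \<union> Inr ` L,
      parcs = {(Inl p, Inr l) | p l. p \<in> Sing L \<and> l \<in> L \<and> p \<in> l} \<union>
              {(Inr l, Inl p) | p l. p \<in> Sing L \<and> l \<in> L \<and> p \<in> l} \<rparr>"

text \<open>The cycle on \<open>n\<close> vertices; this is a simple graph for \<open>n \<ge> 3\<close>.\<close>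

definition cycle_graph :: "nat \<Rightarrow> nat pair_pre_digraph" where
  "cycle_graph n =
    \<lparr> pverts = {..<n},
      parcs = {(i, j). i < n \<and> j < n \<and> (j = (i + 1) mod n \<or> i = (j + 1) mod n)} \<rparr>"

definition has_induced_cycle :: "('a, 'b) pre_digraph \<Rightarrow> nat \<Rightarrow> bool" where
  "has_induced_cycle G n \<longleftrightarrow>
    (\<exists>H. induced_subgraph H G \<and> digraph_iso H (with_proj (cycle_graph n)))"

section \<open>Well-formedness\<close>

lemma proj_lines_meet_once:
  assumes l: "l \<in> proj_lines" and m: "m \<in> proj_lines" and ne: "l \<noteq> m"
    and p: "p \<in> l" "p \<in> m" and q: "q \<in> l" "q \<in> m"
  shows "p = q"
proof (rule ccontr)
  assume pq: "p \<noteq> q"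
  from l obtain U where U: "vec.subspace U" "vec.dim U = 2" "l = {p \<in> proj_points. p \<subseteq> U}"
    unfolding proj_lines_def by blast
  from m obtain W where W: "vec.subspace W" "vec.dim W = 2" "m = {p \<in> proj_points. p \<subseteq> W}"
    unfolding proj_lines_def by blast
  have P: "vec.subspace p" "vec.dim p = 1" "p \<subseteq> U" "p \<subseteq> W"
    and Q: "vec.subspace q" "vec.dim q = 1" "q \<subseteq> U" "q \<subseteq> W"
    using p q U(3) W(3) by (auto simp: proj_points_def)
  have "\<not> q \<subseteq> p"
    using vec.subspace_dim_equal[OF Q(1) P(1)] P(2) Q(2) pq by auto
  then obtain x where x: "x \<in> q" "x \<notin> p" by blast
  have sp: "vec.span p = p" using P(1) vec.span_eq_iff by blast
  let ?S = "vec.span (insert x p)"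
  have d: "vec.dim ?S = 2"
    using x(2) P(2) by (simp add: vec.dim_insert sp)
  have "?S \<subseteq> U" using x(1) P(3) Q(3) U(1) by (intro vec.span_minimal) auto
  then have "?S = U" using vec.subspace_dim_equal[OF _ U(1)] d U(2) by auto
  moreover have "?S \<subseteq> W" using x(1) P(4) Q(4) W(1) by (intro vec.span_minimal) auto
  then have "?S = W" using vec.subspace_dim_equal[OF _ W(1)] d W(2) by auto
  ultimately show False using ne U(3) W(3) by simp
qed

lemma finite_Sing:
  assumes "line_arrangement L"
  shows "finite (Sing L)"
proof -
  have fin: "finite L" and sub: "L \<subseteq> proj_lines"
    using assms by (auto simp: line_arrangement_def)
  let ?P = "{(l, m). l \<in> L \<and> m \<in> L \<and> l \<noteq> m}"
  have "finite ?P" by (rule finite_subset[of _ "L \<times> L"]) (use fin in auto)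
  moreover have "finite (l \<inter> m)" if "(l, m) \<in> ?P" for l m
  proof (cases "l \<inter> m = {}")
    case False
    then obtain p where "p \<in> l \<inter> m" by blast
    then have "l \<inter> m \<subseteq> {p}"
      using that sub proj_lines_meet_once[of l m] by blast
    then show ?thesis using finite_subset by blast
  qed simp
  ultimately have "finite (\<Union>(l, m)\<in>?P. l \<inter> m)" by auto
  moreover have "Sing L \<subseteq> (\<Union>(l, m)\<in>?P. l \<inter> m)"
    by (auto simp: Sing_def)
  ultimately show ?thesis by (rule rev_finite_subset)
qed

lemma pair_graph_levi_graph:
  assumes "line_arrangement L"
  shows "pair_graph (levi_graph L)"
proof -
  have fv: "finite (pverts (levi_graph L))"
    using assms finite_Sing[OF assms] by (simp add: levi_graph_def line_arrangement_def)
  have sub: "parcs (levi_graph L) \<subseteq> pverts (levi_graph L) \<times> pverts (levi_graph L)"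
    by (auto simp: levi_graph_def)
  have "finite (parcs (levi_graph L))"
    using finite_subset[OF sub] fv by simp
  then show ?thesis
    using fv sub by unfold_locales (auto simp: levi_graph_def symmetric_def intro!: symI)
qed

lemma pair_graph_cycle_graph:
  assumes "n \<ge> 3"
  shows "pair_graph (cycle_graph n)"
proof -
  have sub: "parcs (cycle_graph n) \<subseteq> {..<n} \<times> {..<n}"
    by (auto simp: cycle_graph_def)
  have fa: "finite (parcs (cycle_graph n))"
    using finite_subset[OF sub] by simp
  have ne: "i \<noteq> Suc i mod n" if "i < n" for i
    using that assms by (cases "i + 1 = n") auto
  then show ?thesis
    using fa by unfold_locales (auto simp: cycle_graph_def symmetric_def intro!: symI dest: ne)
qed

end

theory Submission
  imports Defs
begin

text \<open>
  Four lines of which no three are concurrent, taken in cyclic order, form an induced 8-cycle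
  together with the intersection points of consecutive lines. The hypotheses say that every
  intersection point misses at least two lines. Take lines \<open>a \<noteq> b\<close> meeting in \<open>p\<close> and lines
  \<open>c \<noteq> d\<close> missing \<open>p\<close>; these four lines do unless \<open>c\<close> and \<open>d\<close> meet on \<open>a\<close> or on \<open>b\<close>. In that case
  some point \<open>q\<close> lies on three lines. Two further lines \<open>l\<close>, \<open>m\<close> miss \<open>q\<close>, and their common point lies
  on at most one of the three lines through \<open>q\<close>, so the other two together with \<open>l\<close>, \<open>m\<close> do.
\<close>

text \<open>Two planes \<open>U\<close> and \<open>W\<close> in complex 3-space have a sum of
  dimension at most 3, so the dimension formula leaves a nonzero vector in
  \<open>U \<inter> W\<close>; its span is the common point. The case \<open>l = m\<close> is
  included.\<close>

lemma proj_lines_meet: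
  assumes l: "l \<in> proj_lines" and m: "m \<in> proj_lines"
  obtains p where "p \<in> proj_points" "p \<in> l" "p \<in> m"
proof -
  from l obtain U where U: "vec.subspace U" "vec.dim U = 2" "l = {p \<in> proj_points. p \<subseteq> U}"
    unfolding proj_lines_def by blast
  from m obtain W where W: "vec.subspace W" "vec.dim W = 2" "m = {p \<in> proj_points. p \<subseteq> W}"
    unfolding proj_lines_def by blast
  have "vec.dim {x + y |x y. x \<in> U \<and> y \<in> W} \<le> 3"
    using vec.dim_subset_UNIV[of "{x + y |x y. x \<in> U \<and> y \<in> W}"] by (simp add: vec.dimension_def card_cart_basis)
  moreover have "vec.dim {x + y |x y. x \<in> U \<and> y \<in> W} + vec.dim (U \<inter> W) = 4"
    using vec.dim_sums_Int[OF U(1) W(1)] U(2) W(2) by simp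
  ultimately have "vec.dim (U \<inter> W) \<noteq> 0" by linarith
  then obtain x where x: "x \<in> U" "x \<in> W" "x \<noteq> 0"
    using vec.dim_eq_0[of "U \<inter> W"] by auto
  have "vec.dim (vec.span {x}) = 1"
    using x(3) by (simp add: vec.dim_insert)
  then have "vec.span {x} \<in> proj_points" by (simp add: proj_points_def)
  moreover have "vec.span {x} \<subseteq> U" "vec.span {x} \<subseteq> W"
    using x U(1) W(1) by (intro vec.span_minimal; simp)+
  ultimately show thesis using that U(3) W(3) by blast
qed

text \<open>Replaces the search for a subgraph and an isomorphism by a cyclic labelling
  \<open>f\<close> of vertices. The equivalence in the last assumption excludes chords, which makes
  the cycle induced.\<close>

lemma has_induced_cycleI:
  assumes G: "pair_wf_digraph G" and inj: "inj_on f {..<n}" and V: "f ` {..<n} \<subseteq> pverts G"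
    and adj: "\<And>i j. i < n \<Longrightarrow> j < n \<Longrightarrow>
      (f i, f j) \<in> parcs G \<longleftrightarrow> j = (i + 1) mod n \<or> i = (j + 1) mod n"
  shows "has_induced_cycle (with_proj G) n"
proof -
  interpret pair_wf_digraph G by (rule G)
  define g where "g = the_inv_into {..<n} f"
  have gf: "g (f i) = i" if "i < n" for i
    using inj that by (simp add: g_def the_inv_into_f_f)
  let ?H = "with_proj G \<restriction> (f ` {..<n})"
  \<comment> \<open>The isomorphism has to run from the subgraph to the cycle, hence the inverse
    \<open>g\<close> of \<open>f\<close>. Arcs are vertex pairs, so \<open>g\<close> acts on them
    componentwise.\<close>
  let ?h = "\<lparr>iso_verts = g, iso_arcs = map_prod g g, iso_head = snd, iso_tail = fst\<rparr>"
  have ind: "induced_subgraph ?H (with_proj G)"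
    using V by (intro induced_induce) simp
  have arcs_H: "arcs ?H = map_prod f f ` parcs (cycle_graph n)"
    using adj by (force simp: cycle_graph_def)
  have "inj_on g (f ` {..<n})"
    by (auto simp: inj_on_def gf)
  moreover have "inj_on (map_prod g g) (arcs ?H)"
    by (rule inj_onI) (auto simp: arcs_H cycle_graph_def gf)
  moreover have "wf_digraph ?H" by (rule wf_digraphI_induced[OF ind])
  ultimately have "pre_digraph.digraph_isomorphism ?H ?h"
    by (auto simp: pre_digraph.digraph_isomorphism_def induce_subgraph_def)
  moreover have "with_proj (cycle_graph n) = app_iso ?h ?H"
  proof -
    have "map_prod g g ` arcs ?H = parcs (cycle_graph n)"
      unfolding arcs_H image_image by (force simp: cycle_graph_def gf)
    moreover have "g ` f ` {..<n} = pverts (cycle_graph n)"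
      unfolding image_image by (force simp: cycle_graph_def gf)
    ultimately show ?thesis
      by (simp add: app_iso_def with_proj_def del: induce_subgraph_arcs)
  qed
  ultimately show ?thesis
    using ind unfolding has_induced_cycle_def digraph_iso_def by blast
qed

lemma generic_lines_induced_cycle:
  assumes L: "line_arrangement L" and abcd: "{a, b, c, d} \<subseteq> L"
    and generic: "a \<inter> b \<inter> c = {}" "b \<inter> c \<inter> d = {}" "c \<inter> d \<inter> a = {}" "d \<inter> a \<inter> b = {}"
  shows "has_induced_cycle (with_proj (levi_graph L)) 8"
proof -
  have lines: "a \<in> proj_lines" "b \<in> proj_lines" "c \<in> proj_lines" "d \<in> proj_lines"
    using L abcd by (auto simp: line_arrangement_def)
  obtain p where p: "p \<in> proj_points" "p \<in> a" "p \<in> b" by (rule proj_lines_meet[OF lines(1,2)])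
  obtain q where q: "q \<in> proj_points" "q \<in> b" "q \<in> c" by (rule proj_lines_meet[OF lines(2,3)])
  obtain r where r: "r \<in> proj_points" "r \<in> c" "r \<in> d" by (rule proj_lines_meet[OF lines(3,4)])
  obtain s where s: "s \<in> proj_points" "s \<in> d" "s \<in> a" by (rule proj_lines_meet[OF lines(4,1)])
  have off: "p \<notin> c" "p \<notin> d" "q \<notin> d" "q \<notin> a" "r \<notin> a" "r \<notin> b" "s \<notin> b" "s \<notin> c"
    using p q r s generic by blast+
  \<comment> \<open>Genericity already forces distinctness: any two of the four lines are separated
    by one of the four points, for instance \<open>a\<close> and \<open>b\<close> by
    \<open>s\<close>.\<close>
  have ne_l: "a \<noteq> b" "a \<noteq> c" "a \<noteq> d" "b \<noteq> c" "b \<noteq> d" "c \<noteq> d"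
    using p q r s off by blast+
  have ne_p: "p \<noteq> q" "p \<noteq> r" "p \<noteq> s" "q \<noteq> r" "q \<noteq> s" "r \<noteq> s"
    using p q r s off by blast+
  have sing: "p \<in> Sing L" "q \<in> Sing L" "r \<in> Sing L" "s \<in> Sing L"
    using p q r s abcd ne_l unfolding Sing_def by blast+
  \<comment> \<open>Neighbours in the list are incident, and \<open>s\<close> on \<open>a\<close>
    closes the cycle.\<close>
  define vs where "vs = [Inr a, Inl p, Inr b, Inl q, Inr c, Inl r, Inr d, Inl s]"
  have len: "length vs = 8" by (simp add: vs_def)
  have "distinct vs" using ne_l ne_p by (auto simp: vs_def)
  then have inj: "inj_on ((!) vs) {..<8}" by (simp add: inj_on_nth len)
  have "set vs \<subseteq> pverts (levi_graph L)"
    using sing abcd by (auto simp: vs_def levi_graph_def)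
  then have V: "(!) vs ` {..<8} \<subseteq> pverts (levi_graph L)"
    using len by (auto simp: subset_iff)
  have nat8: "i = 0 \<or> i = 1 \<or> i = 2 \<or> i = 3 \<or> i = 4 \<or> i = 5 \<or> i = 6 \<or> i = 7" if "i < 8" for i :: nat
    using that by linarith
  have arcs: "(Inl x, Inr l) \<in> parcs (levi_graph L) \<longleftrightarrow> x \<in> Sing L \<and> l \<in> L \<and> x \<in> l"
    "(Inr l, Inl x) \<in> parcs (levi_graph L) \<longleftrightarrow> x \<in> Sing L \<and> l \<in> L \<and> x \<in> l"
    "(Inl x, Inl y) \<notin> parcs (levi_graph L)" "(Inr l, Inr m) \<notin> parcs (levi_graph L)" for x y l m
    by (auto simp: levi_graph_def)
  \<comment> \<open>A line and a point that are not neighbours are at cyclic distance 3; these eight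
    pairs are exactly the non-incidences in \<open>off\<close>. All remaining non-adjacencies hold
    by bipartiteness.\<close>
  have adj: "(vs ! i, vs ! j) \<in> parcs (levi_graph L) \<longleftrightarrow> j = (i + 1) mod 8 \<or> i = (j + 1) mod 8"
    if "i < 8" "j < 8" for i j
    using nat8[OF that(1)] nat8[OF that(2)] p q r s off sing abcd
    by (elim disjE) (simp_all add: vs_def arcs)
  have "pair_wf_digraph (levi_graph L)"
    using pair_graph_levi_graph[OF L]
    by (simp add: pair_graph_def pair_digraph_def pair_fin_digraph_def)
  then show ?thesis using inj V adj by (rule has_induced_cycleI)
qed

lemma obtains_two_lines_off_point:
  assumes L: "line_arrangement L" and k: "card L = k" "k \<ge> 2"
    and t: "num_fold_points k L = 0" "num_fold_points (k - 1) L = 0" and p: "p \<in> Sing L"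
  obtains l m where "l \<in> L" "m \<in> L" "l \<noteq> m" "p \<notin> l" "p \<notin> m"
proof -
  have fin: "finite L" using L by (simp add: line_arrangement_def)
  \<comment> \<open>Cardinality 0 excludes \<open>p\<close> only because \<open>Sing L\<close> is
    finite; an infinite set would also have \<open>card\<close> 0.\<close>
  have "card {l \<in> L. p \<in> l} \<noteq> r" if "num_fold_points r L = 0" for r
    using that finite_Sing[OF L] p by (auto simp: num_fold_points_def)
  then have "card {l \<in> L. p \<in> l} \<noteq> k" "card {l \<in> L. p \<in> l} \<noteq> k - 1"
    using t by blast+
  moreover have "card L = card {l \<in> L. p \<in> l} + card {l \<in> L. p \<notin> l}"
    using fin by (subst card_Un_disjoint[symmetric]) (auto intro!: arg_cong[where f = card])
  ultimately have "card {l \<in> L. p \<notin> l} \<ge> 2" using k by linarith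
  then obtain S where "S \<subseteq> {l \<in> L. p \<notin> l}" "card S = 2"
    by (meson obtain_subset_with_card_n)
  then show thesis using that by (auto simp: card_2_iff)
qed

theorem theorem4p2:
  fixes L :: "proj_line set" and k :: nat
  assumes "line_arrangement L"
    and "card L = k"
    and "k \<ge> 2"
    and "num_fold_points k L = 0"
    and "num_fold_points (k - 1) L = 0"
  shows "has_induced_cycle (with_proj (levi_graph L)) 8"
proof -
  note two_off = obtains_two_lines_off_point[OF assms]
  have lines: "l \<in> proj_lines" if "l \<in> L" for l
    using assms(1) that by (auto simp: line_arrangement_def)
  note once = proj_lines_meet_once[OF lines lines]
  note cycle = generic_lines_induced_cycle[OF assms(1)]
  have triple: ?thesis
    if xyz: "x \<in> L" "y \<in> L" "z \<in> L" "x \<noteq> y" "y \<noteq> z" "x \<noteq> z"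
      and q: "q \<in> Sing L" "q \<in> x" "q \<in> y" "q \<in> z" for x y z q
  proof -
    obtain l m where lm: "l \<in> L" "m \<in> L" "l \<noteq> m" "q \<notin> l" "q \<notin> m" by (rule two_off[OF q(1)])
    obtain r where r: "r \<in> l" "r \<in> m" using proj_lines_meet[OF lines lines] lm by metis
    \<comment> \<open>Any three of \<open>u\<close>, \<open>v\<close>, \<open>l\<close>,
      \<open>m\<close> include both \<open>u\<close> and \<open>v\<close>, meeting only in
      \<open>q\<close>, or both \<open>l\<close> and \<open>m\<close>, meeting only in
      \<open>r\<close>. So it suffices that \<open>q\<close> avoids \<open>l\<close>,
      \<open>m\<close> and \<open>r\<close> avoids \<open>u\<close>, \<open>v\<close>.\<close>
    have two: ?thesis
      if uv: "u \<in> L" "v \<in> L" "u \<noteq> v" "q \<in> u" "q \<in> v" "r \<notin> u" "r \<notin> v" for u v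
    proof (rule cycle)
      show "{u, v, l, m} \<subseteq> L" using uv lm by auto
      have "u \<inter> v \<subseteq> {q}" using once[of u v _ q] uv by blast
      moreover have "l \<inter> m \<subseteq> {r}" using once[of l m _ r] lm r by blast
      ultimately show "u \<inter> v \<inter> l = {}" "v \<inter> l \<inter> m = {}" "l \<inter> m \<inter> u = {}" "m \<inter> u \<inter> v = {}"
        using uv lm by blast+
    qed
    have "r \<noteq> q" using r lm by blast
    \<comment> \<open>Two lines through both \<open>q\<close> and \<open>r\<close> would coincide,
      so at least two of \<open>x\<close>, \<open>y\<close>, \<open>z\<close> avoid
      \<open>r\<close>.\<close>
    then have "\<not> (r \<in> u \<and> r \<in> v)" if "u \<in> L" "v \<in> L" "u \<noteq> v" "q \<in> u" "q \<in> v" for u v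
      using once[of u v r q] that by blast
    then show ?thesis using two xyz q by metis
  qed
  obtain a b where ab: "a \<in> L" "b \<in> L" "a \<noteq> b"
    using assms(2,3) by (metis card_2_iff obtain_subset_with_card_n insert_subset)
  obtain p where p: "p \<in> proj_points" "p \<in> a" "p \<in> b"
    using proj_lines_meet[OF lines lines] ab by metis
  then have "p \<in> Sing L" using ab by (auto simp: Sing_def)
  then obtain c d where cd: "c \<in> L" "d \<in> L" "c \<noteq> d" "p \<notin> c" "p \<notin> d" by (rule two_off)
  obtain q where q: "q \<in> proj_points" "q \<in> c" "q \<in> d"
    using proj_lines_meet[OF lines lines] cd by metis
  have "q \<in> Sing L" using q cd by (auto simp: Sing_def)
  show ?thesis
  proof (cases "q \<in> a \<or> q \<in> b")
    case True
    \<comment> \<open>The line \<open>a\<close> or \<open>b\<close> through \<open>q\<close> differs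
      from \<open>c\<close> and \<open>d\<close> because it contains \<open>p\<close>.\<close>
    then show ?thesis
      using triple[of a c d q] triple[of b c d q] ab cd p q \<open>q \<in> Sing L\<close> by blast
  next
    case False
    show ?thesis
    proof (rule cycle)
      show "{a, b, c, d} \<subseteq> L" using ab cd by auto
      have "a \<inter> b \<subseteq> {p}" using once[of a b _ p] ab p by blast
      moreover have "c \<inter> d \<subseteq> {q}" using once[of c d _ q] cd q by blast
      ultimately show "a \<inter> b \<inter> c = {}" "b \<inter> c \<inter> d = {}" "c \<inter> d \<inter> a = {}" "d \<inter> a \<inter> b = {}"
        using False cd by blast+
    qed
  qed
qed

end
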